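(* For every sufficiently large natural number $n$, \[ \frac{n^2-n}{2} = \binom{n}{2} \le g(n) \le n^3. \]
   Context: Let $P$ be a set of $2n$ points in the plane in general position (no three on a line). A perfect straight-line matching $M$ on $P$ is a set of $n$ segments with endpoints in $P$ such that each point of $P$ is an endpoint of exactly one segment; $M$ is non-crossing if no two of its segments cross. If two segments $\mathrm{seg}(a,b),\mathrm{seg}(c,d)$ of $M$ cross, a flip replaces them by two non-crossing segments on the same four points $\{a,b,c,d\}$ (either $\mathrm{seg}(a,c),\mathrm{seg}(b,d)$ or $\mathrm{seg}(a,d),\mathrm{seg}(b,c)$, whichever pair does not cross), yielding a new perfect matching called a successor of $M$. A valid sequence of length $k$ starting at $M$ is a sequence $(M_0,\dots,M_k)$ with $M_0=M$, each $M_{i+1}$ a successor of $M_i$, and $M_k$ non-crossing. Let $f(M)$ be the maximum length of a valid sequence starting at $M$, and let $g(n)$ be the maximum of $f(M)$ over all perfect straight-line matchings $M$ on all sets of $2n$ points in the plane in general position. *)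

theory Defs
  imports "HOL-Analysis.Analysis" "HOL-Library.Extended_Nat"
begin

type_synonym point = "real^2"

definition general_position :: "point set \<Rightarrow> bool" where
  "general_position P \<longleftrightarrow>
     (\<forall>a\<in>P. \<forall>b\<in>P. \<forall>c\<in>P. a \<noteq> b \<and> a \<noteq> c \<and> b \<noteq> c \<longrightarrow> \<not> collinear {a, b, c})"

text \<open>The segment with endpoints \<open>a \<noteq> b\<close> is encoded by the two-element set \<open>{a, b}\<close>, so a
  matching is a set of two-element sets of points.\<close>

definition perfect_matching :: "point set \<Rightarrow> point set set \<Rightarrow> bool" where
  "perfect_matching P M \<longleftrightarrow>
     (\<forall>e\<in>M. e \<subseteq> P \<and> card e = 2) \<and> (\<forall>p\<in>P. \<exists>!e. e \<in> M \<and> p \<in> e)"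

definition segs_cross :: "point \<Rightarrow> point \<Rightarrow> point \<Rightarrow> point \<Rightarrow> bool" where
  "segs_cross a b c d \<longleftrightarrow>
     {a, b} \<noteq> {c, d} \<and> open_segment a b \<inter> open_segment c d \<noteq> {}"

definition non_crossing :: "point set set \<Rightarrow> bool" where
  "non_crossing M \<longleftrightarrow>
     (\<forall>a b c d. {a, b} \<in> M \<and> {c, d} \<in> M \<longrightarrow> \<not> segs_cross a b c d)"

text \<open>The variables \<open>c\<close> and \<open>d\<close> may be exchanged, so replacing the two segments by
  \<open>{a, d}\<close> and \<open>{b, c}\<close> is covered as well.\<close>

definition successor :: "point set set \<Rightarrow> point set set \<Rightarrow> bool" where
  "successor M M' \<longleftrightarrow>
     (\<exists>a b c d. {a, b} \<in> M \<and> {c, d} \<in> M \<and> segs_cross a b c d \<and>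
        \<not> segs_cross a c b d \<and>
        M' = (M - {{a, b}, {c, d}}) \<union> {{a, c}, {b, d}})"

definition valid_sequence :: "point set set \<Rightarrow> nat \<Rightarrow> (nat \<Rightarrow> point set set) \<Rightarrow> bool" where
  "valid_sequence M k Ms \<longleftrightarrow>
     Ms 0 = M \<and> (\<forall>i<k. successor (Ms i) (Ms (Suc i))) \<and> non_crossing (Ms k)"

text \<open>Maxima are taken as suprema in \<^typ>\<open>enat\<close>: the value is \<open>\<infinity>\<close> if the lengths are
  unbounded, and a finite supremum of a nonempty set is attained, hence is its maximum.\<close>

definition max_flips :: "point set set \<Rightarrow> enat" where
  "max_flips M = Sup {enat k | k. \<exists>Ms. valid_sequence M k Ms}"

definition max_flips_of_size :: "nat \<Rightarrow> enat" where
  "max_flips_of_size n = Sup {max_flips M | P M.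
     finite P \<and> card P = 2 * n \<and> general_position P \<and> perfect_matching P M}"

end

theory Submission
  imports Defs
begin

text \<open>Upper bound: for every ordered pair \<open>(p, q)\<close> of distinct points, count the segments with exactly
  one endpoint strictly to the left of the line \<open>pq\<close>. This is the number of segments crossing a line
  shifted slightly to the left of \<open>pq\<close>. Each of these \<open>2n(2n - 1)\<close> counts is at most \<open>n\<close>, none of them
  increases under a flip, and a flip lowers at least two of them by two. Hence there are at most
  \<open>n\<^sup>3\<close> flips.

  Lower bound: put \<open>n\<close> points on each of the two branches of the parabola \<open>y = x\<^sup>2\<close> and join
  them according to a permutation. Two chords cross exactly if they form an inversion, and
  exchanging two adjacent inverted entries is a flip. Bubble sort of the reversed list makes
  \<open>n choose 2\<close> such exchanges and ends in parallel chords.\<close>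

section \<open>Orientation\<close>

text \<open>Twice the signed area of the triangle \<open>p q x\<close>: positive exactly when
  \<open>x\<close> lies to the left of the directed line from \<open>p\<close> to
  \<open>q\<close>.\<close>

definition orient :: "point \<Rightarrow> point \<Rightarrow> point \<Rightarrow> real" where
  "orient p q x = (q$1 - p$1) * (x$2 - p$2) - (q$2 - p$2) * (x$1 - p$1)"

definition left_of :: "point \<Rightarrow> point \<Rightarrow> point set" where
  "left_of p q = {x. orient p q x > 0}"

lemma orient_affine:
  "orient p q ((1 - u) *\<^sub>R a + u *\<^sub>R b) = (1 - u) * orient p q a + u * orient p q b"
  by (simp add: orient_def algebra_simps)

lemma orient_swap: "orient q p x = - orient p q x"
  by (simp add: orient_def algebra_simps)

lemma orient_self [simp]: "orient p q p = 0" "orient p q q = 0"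
  by (simp_all add: orient_def)

lemma collinear_iff_orient: "collinear {a, b, c} \<longleftrightarrow> orient a b c = 0"
proof -
  define x where "x = a - b"
  define z where "z = c - b"
  have eq: "orient a b c = z$1 * x$2 - z$2 * x$1"
    by (simp add: orient_def x_def z_def algebra_simps)
  have "collinear {0, x, z} \<longleftrightarrow> z$1 * x$2 - z$2 * x$1 = 0"
  proof
    assume "collinear {0, x, z}"
    then show "z$1 * x$2 - z$2 * x$1 = 0"
      by (auto simp: collinear_lemma)
  next
    assume *: "z$1 * x$2 - z$2 * x$1 = 0"
    \<comment> \<open>If \<open>x\<close> has a nonzero coordinate, the quotient of the
      corresponding coordinates gives \<open>z\<close> as a multiple of \<open>x\<close>; otherwise
      \<open>x\<close> is the origin.\<close>
    show "collinear {0, x, z}"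
    proof (cases "x$1 = 0")
      case False
      then have "z = (z$1 / x$1) *\<^sub>R x"
        using * by (simp add: vec_eq_iff forall_2 field_simps)
      then show ?thesis
        unfolding collinear_lemma by blast
    next
      case True
      show ?thesis
      proof (cases "x$2 = 0")
        case True
        with \<open>x$1 = 0\<close> have "x = 0"
          by (simp add: vec_eq_iff forall_2)
        then show ?thesis
          by (simp add: collinear_lemma)
      next
        case False
        then have "z = (z$2 / x$2) *\<^sub>R x"
          using * True by (simp add: vec_eq_iff forall_2 field_simps)
        then show ?thesis
          unfolding collinear_lemma by blast
      qed
    qed
  qed
  moreover have "collinear {a, b, c} \<longleftrightarrow> collinear {0, x, z}"
    unfolding x_def z_def by (rule collinear_3) (simp add: NO_MATCH_def)
  ultimately show ?thesis
    by (simp add: eq)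
qed

section \<open>Crossing segments and half-planes\<close>

lemma segs_crossE:
  assumes "segs_cross a b c d"
  obtains u v where "0 < u" "u < 1" "0 < v" "v < 1"
    "(1 - u) *\<^sub>R a + u *\<^sub>R b = (1 - v) *\<^sub>R c + v *\<^sub>R d"
  using assms unfolding segs_cross_def by (auto simp: in_segment)

text \<open>The weights come from one common point, so the same \<open>u\<close> and
  \<open>v\<close> serve every line \<open>p q\<close>; later arguments choose the line
  afterwards.\<close>

lemma crossing_orient:
  assumes "segs_cross a b c d"
  obtains u v where "0 < u" "u < 1" "0 < v" "v < 1"
    "\<And>p q. (1 - u) * orient p q a + u * orient p q b = (1 - v) * orient p q c + v * orient p q d"
  using assms by (metis segs_crossE orient_affine)

text \<open>The common point is a strict convex combination of \<open>a\<close> and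
  \<open>b\<close>, hence strictly left of the line; \<open>c\<close> and \<open>d\<close> outside
  the open half-plane would keep it outside.\<close>

lemma crossing_not_separated:
  assumes "segs_cross a b c d" "a \<in> left_of p q" "b \<in> left_of p q"
  shows "c \<in> left_of p q \<or> d \<in> left_of p q"
proof (rule ccontr)
  assume *: "\<not> ?thesis"
  obtain u v where uv: "0 < u" "u < 1" "0 < v" "v < 1"
    and eq: "\<And>p q. (1 - u) * orient p q a + u * orient p q b
        = (1 - v) * orient p q c + v * orient p q d"
    using crossing_orient[OF assms(1)] by metis
  have "(1 - u) * orient p q a + u * orient p q b > 0"
    using uv assms by (intro add_pos_pos mult_pos_pos) (auto simp: left_of_def)
  moreover have "(1 - v) * orient p q c + v * orient p q d \<le> 0"
    using uv * by (intro add_nonpos_nonpos mult_nonneg_nonpos) (auto simp: left_of_def)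
  ultimately show False
    using eq[of p q] by linarith
qed

text \<open>On the line \<open>a c\<close> the terms of \<open>a\<close> and \<open>c\<close>
  vanish, leaving positive multiples of the orientations of \<open>b\<close> and \<open>d\<close>
  that agree. The cases say which direction of the line has both on its left.\<close>

lemma crossing_same_side:
  assumes "segs_cross a b c d" "\<not> collinear {a, c, b}" "\<not> collinear {a, c, d}"
  obtains "b \<in> left_of a c" "d \<in> left_of a c" "a \<notin> left_of a c" "c \<notin> left_of a c"
  | "b \<in> left_of c a" "d \<in> left_of c a" "a \<notin> left_of c a" "c \<notin> left_of c a"
proof -
  obtain u v where uv: "0 < u" "u < 1" "0 < v" "v < 1"
    and eq: "\<And>p q. (1 - u) * orient p q a + u * orient p q b
        = (1 - v) * orient p q c + v * orient p q d"
    using crossing_orient[OF assms(1)] by metis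
  have *: "u * orient a c b = v * orient a c d"
    using eq[of a c] by simp
  have nz: "orient a c b \<noteq> 0"
    using assms(2) by (simp add: collinear_iff_orient)
  show thesis
  proof (cases "orient a c b > 0")
    case True
    with uv have "v * orient a c d > 0"
      by (simp flip: *)
    with uv True show thesis
      by (intro that(1)) (auto simp: left_of_def zero_less_mult_iff)
  next
    case False
    with uv nz have "v * orient a c d < 0"
      by (simp flip: * add: mult_less_0_iff)
    with uv False nz show thesis
      by (intro that(2)) (auto simp: left_of_def mult_less_0_iff orient_swap[of c a])
  qed
qed

section \<open>Flips preserve perfect matchings\<close>

lemma perfect_matching_unique:
  assumes "perfect_matching P M" "e \<in> M" "e' \<in> M" "p \<in> e" "p \<in> e'"
  shows "e = e'"
proof -
  have "p \<in> P"
    using assms unfolding perfect_matching_def by blast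
  then have "\<exists>!e. e \<in> M \<and> p \<in> e"
    using assms(1) unfolding perfect_matching_def by blast
  then show ?thesis
    using assms by blast
qed

lemma perfect_matching_finite:
  assumes "perfect_matching P M" "finite P"
  shows "finite M"
  by (rule finite_subset[of _ "Pow P"]) (use assms in \<open>auto simp: perfect_matching_def\<close>)

lemma card_perfect_matching:
  assumes "perfect_matching P M" "finite P"
  shows "card P = 2 * card M"
proof -
  have "P = \<Union>M"
    using assms(1) unfolding perfect_matching_def by blast
  moreover have "card (\<Union>M) = sum card M"
  proof (rule card_Union_disjoint)
    show "pairwise disjnt M"
      using perfect_matching_unique[OF assms(1)] by (auto simp: pairwise_def disjnt_def)
    show "finite e" if "e \<in> M" for e
      using assms(1) that by (auto simp: perfect_matching_def intro: card_ge_0_finite)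
  qed
  moreover have "sum card M = (\<Sum>e\<in>M. 2)"
    using assms(1) by (intro sum.cong) (auto simp: perfect_matching_def)
  ultimately show ?thesis
    by simp
qed

text \<open>A shared endpoint would make the two segments equal by uniqueness in \<open>M\<close>,
  which \<open>segs_cross\<close> excludes.\<close>

lemma matched_crossing_distinct:
  assumes "perfect_matching P M" "{a, b} \<in> M" "{c, d} \<in> M" "segs_cross a b c d"
  shows "a \<noteq> b" "a \<noteq> c" "a \<noteq> d" "b \<noteq> c" "b \<noteq> d" "c \<noteq> d"
    and "a \<in> P" "b \<in> P" "c \<in> P" "d \<in> P"
proof -
  have ne: "{a, b} \<noteq> {c, d}"
    using assms(4) by (simp add: segs_cross_def)
  have "card {a, b} = 2" "card {c, d} = 2" "{a, b} \<subseteq> P" "{c, d} \<subseteq> P"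
    using assms by (auto simp: perfect_matching_def)
  then show "a \<noteq> b" "c \<noteq> d" "a \<in> P" "b \<in> P" "c \<in> P" "d \<in> P"
    by auto
  show "a \<noteq> c" "a \<noteq> d" "b \<noteq> c" "b \<noteq> d"
    using ne perfect_matching_unique[OF assms(1-3)] by auto
qed

lemma perfect_matching_flip:
  assumes pm: "perfect_matching P M" and e: "{a, b} \<in> M" "{c, d} \<in> M" and cr: "segs_cross a b c d"
  shows "perfect_matching P (M - {{a, b}, {c, d}} \<union> {{a, c}, {b, d}})" (is "perfect_matching P ?M'")
proof -
  note dist = matched_crossing_distinct[OF pm e cr]
  note uniq = perfect_matching_unique[OF pm]
  have "e \<subseteq> P \<and> card e = 2" if "e \<in> ?M'" for e
    using that pm dist by (auto simp: perfect_matching_def)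
  moreover have "\<exists>!e. e \<in> ?M' \<and> p \<in> e" if p: "p \<in> P" for p
  proof -
    \<comment> \<open>None of the four flipped points lies on a surviving segment, so each is
      covered by a new segment only.\<close>
    have old: "e = {a, b}" if "e \<in> M" "a \<in> e \<or> b \<in> e" for e
      using uniq[OF that(1) e(1)] that(2) by auto
    have old': "e = {c, d}" if "e \<in> M" "c \<in> e \<or> d \<in> e" for e
      using uniq[OF that(1) e(2)] that(2) by auto
    consider "p = a \<or> p = c" | "p = b \<or> p = d" | "p \<notin> {a, b, c, d}"
      by blast
    then show ?thesis
    proof cases
      case 1
      show ?thesis
      proof (rule ex1I[of _ "{a, c}"])
        fix e assume e: "e \<in> ?M' \<and> p \<in> e"
        then have "e \<noteq> {b, d}"
          using 1 dist by auto
        moreover have "e \<notin> M - {{a, b}, {c, d}}"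
          using e 1 old old' by blast
        ultimately show "e = {a, c}"
          using e by blast
      qed (use 1 in auto)
    next
      case 2
      show ?thesis
      proof (rule ex1I[of _ "{b, d}"])
        fix e assume e: "e \<in> ?M' \<and> p \<in> e"
        then have "e \<noteq> {a, c}"
          using 2 dist by auto
        moreover have "e \<notin> M - {{a, b}, {c, d}}"
          using e 2 old old' by blast
        ultimately show "e = {b, d}"
          using e by blast
      qed (use 2 in auto)
    next
      case 3
      then have "e \<in> ?M' \<and> p \<in> e \<longleftrightarrow> e \<in> M \<and> p \<in> e" for e
        by auto
      then show ?thesis
        using pm p by (simp add: perfect_matching_def)
    qed
  qed
  ultimately show ?thesis
    unfolding perfect_matching_def by (intro conjI[OF ballI ballI])
qed

section \<open>Upper bound\<close>

definition cut_number :: "'a set \<Rightarrow> 'a set set \<Rightarrow> nat" where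
  "cut_number S M = (\<Sum>e\<in>M. of_bool (e \<inter> S \<noteq> {} \<and> e - S \<noteq> {}))"

lemma cut_number_le_card: "cut_number S M \<le> card M"
  unfolding cut_number_def using sum_bounded_above[of M _ "1::nat"] by (simp add: of_bool_def)

lemma cut_number_Un_pair:
  assumes "finite N" "{a, b} \<notin> N" "{c, d} \<notin> N" "{a, b} \<noteq> {c, d}"
  shows "cut_number S (N \<union> {{a, b}, {c, d}}) =
    cut_number S N + of_bool (a \<in> S \<longleftrightarrow> b \<notin> S) + of_bool (c \<in> S \<longleftrightarrow> d \<notin> S)"
proof -
  have "cut_number S {{a, b}, {c, d}} = of_bool (a \<in> S \<longleftrightarrow> b \<notin> S) + of_bool (c \<in> S \<longleftrightarrow> d \<notin> S)"
    using assms(4) by (simp add: cut_number_def)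
  moreover have "cut_number S (N \<union> {{a, b}, {c, d}}) = cut_number S N + cut_number S {{a, b}, {c, d}}"
    unfolding cut_number_def using assms by (intro sum.union_disjoint) auto
  ultimately show ?thesis
    by simp
qed

text \<open>The untouched segments contribute equally before and after. The contributions of the
  flipped segments are added crosswise because subtraction on \<open>nat\<close> truncates.\<close>

lemma cut_number_flip:
  assumes pm: "perfect_matching P M" "finite P"
    and e: "{a, b} \<in> M" "{c, d} \<in> M" and cr: "segs_cross a b c d"
    and M': "M' = M - {{a, b}, {c, d}} \<union> {{a, c}, {b, d}}"
  shows "cut_number S M + of_bool (a \<in> S \<longleftrightarrow> c \<notin> S) + of_bool (b \<in> S \<longleftrightarrow> d \<notin> S) =
    cut_number S M' + of_bool (a \<in> S \<longleftrightarrow> b \<notin> S) + of_bool (c \<in> S \<longleftrightarrow> d \<notin> S)"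
proof -
  note dist = matched_crossing_distinct[OF pm(1) e cr]
  note uniq = perfect_matching_unique[OF pm(1)]
  define N where "N = M - {{a, b}, {c, d}}"
  have M: "M = N \<union> {{a, b}, {c, d}}"
    using e by (auto simp: N_def)
  have fin: "finite N"
    using perfect_matching_finite[OF pm] by (simp add: N_def)
  \<comment> \<open>The new segments must not merge with segments already present, or the sum over
    \<open>M'\<close> would count them once too few.\<close>
  have "{a, c} \<notin> M"
    using uniq[OF e(1), of "{a, c}" a] dist by (auto simp: doubleton_eq_iff)
  moreover have "{b, d} \<notin> M"
    using uniq[OF e(1), of "{b, d}" b] dist by (auto simp: doubleton_eq_iff)
  ultimately have "cut_number S M' =
    cut_number S N + of_bool (a \<in> S \<longleftrightarrow> c \<notin> S) + of_bool (b \<in> S \<longleftrightarrow> d \<notin> S)"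
    unfolding M' N_def[symmetric] using fin dist
    by (intro cut_number_Un_pair) (auto simp: N_def doubleton_eq_iff)
  moreover have "cut_number S M =
    cut_number S N + of_bool (a \<in> S \<longleftrightarrow> b \<notin> S) + of_bool (c \<in> S \<longleftrightarrow> d \<notin> S)"
    using fin dist by (subst M, intro cut_number_Un_pair) (auto simp: N_def doubleton_eq_iff)
  ultimately show ?thesis
    by simp
qed

section \<open>The potential and its decrease\<close>

definition potential :: "point set \<Rightarrow> point set set \<Rightarrow> nat" where
  "potential P M = (\<Sum>(p, q) \<in> P \<times> P - Id. cut_number (left_of p q) M)"

lemma card_off_diagonal:
  assumes "finite P"
  shows "card (P \<times> P - Id) = card P * card P - card P"
proof -
  have "P \<times> P - Id = P \<times> P - (\<lambda>p. (p, p)) ` P"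
    by auto
  then show ?thesis
    using assms by (simp add: card_Diff_subset card_image inj_on_def card_cartesian_product image_subset_iff)
qed

lemma potential_le:
  assumes "perfect_matching P M" "finite P" "card P = 2 * n"
  shows "potential P M \<le> 4 * n ^ 3"
proof -
  have "card M = n"
    using card_perfect_matching[OF assms(1,2)] assms(3) by simp
  then have "potential P M \<le> (\<Sum>(p, q) \<in> P \<times> P - Id. n)"
    unfolding potential_def using cut_number_le_card[of _ M] by (intro sum_mono) auto
  also have "\<dots> = (2 * n * (2 * n) - 2 * n) * n"
    using assms by (simp add: card_off_diagonal case_prod_unfold)
  \<comment> \<open>Rounding up to \<open>4 * n ^ 3\<close> matches the decrease of 4 per
    flip.\<close>
  also have "\<dots> \<le> (2 * n * (2 * n)) * n"
    by (intro mult_right_mono) auto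
  finally show ?thesis
    by (simp add: power3_eq_cube mult_ac)
qed

text \<open>No line separates the two removed segments from each other, so no cut number increases.
  The two new segments lie on opposite sides of the quadrilateral, so the oriented line along
  either of them, with the other one strictly to its left, loses two cut segments.\<close>

lemma potential_successor:
  assumes pm: "perfect_matching P M" "finite P" and gp: "general_position P"
    and suc: "successor M M'"
  shows "perfect_matching P M'" "potential P M' + 4 \<le> potential P M"
proof -
  obtain a b c d where e: "{a, b} \<in> M" "{c, d} \<in> M" and cr: "segs_cross a b c d"
    and M': "M' = M - {{a, b}, {c, d}} \<union> {{a, c}, {b, d}}"
    using suc unfolding successor_def by blast
  note dist = matched_crossing_distinct[OF pm(1) e cr]
  note flip = cut_number_flip[OF pm e cr M']
  show "perfect_matching P M'"
    unfolding M' by (rule perfect_matching_flip[OF pm(1) e cr])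
  \<comment> \<open>The first form exchanges the roles of the two segments; the second makes
    \<open>crossing_same_side\<close> speak about the line \<open>b d\<close>.\<close>
  have cr': "segs_cross c d a b" "segs_cross b a d c"
    using cr unfolding segs_cross_def by (auto simp: open_segment_commute insert_commute)
  \<comment> \<open>The count could rise only with \<open>a\<close>, \<open>b\<close> on one side
    and \<open>c\<close>, \<open>d\<close> on the other; the two instances exclude both orientations
    of this.\<close>
  have mono: "cut_number (left_of p q) M' \<le> cut_number (left_of p q) M" for p q
    using flip[of "left_of p q"] crossing_not_separated[OF cr, of p q]
      crossing_not_separated[OF cr'(1), of p q]
    by (auto simp: of_bool_def split: if_splits)
  have nc: "\<not> collinear {x, y, z}" if "{x, y, z} \<subseteq> P" "x \<noteq> y" "x \<noteq> z" "y \<noteq> z" for x y z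
    using gp that unfolding general_position_def by auto
  obtain s where s: "s = (a, c) \<or> s = (c, a)"
    "b \<in> left_of (fst s) (snd s)" "d \<in> left_of (fst s) (snd s)"
    "a \<notin> left_of (fst s) (snd s)" "c \<notin> left_of (fst s) (snd s)"
  proof (rule crossing_same_side[OF cr])
    show "\<not> collinear {a, c, b}" "\<not> collinear {a, c, d}"
      using dist by (intro nc; auto)+
  qed (use that[of "(a, c)"] that[of "(c, a)"] in auto)
  obtain t where t: "t = (b, d) \<or> t = (d, b)"
    "a \<in> left_of (fst t) (snd t)" "c \<in> left_of (fst t) (snd t)"
    "b \<notin> left_of (fst t) (snd t)" "d \<notin> left_of (fst t) (snd t)"
  proof (rule crossing_same_side[OF cr'(2)])
    show "\<not> collinear {b, d, a}" "\<not> collinear {b, d, c}"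
      using dist by (intro nc; auto)+
  qed (use that[of "(b, d)"] that[of "(d, b)"] in auto)
  let ?D = "P \<times> P - Id" and ?L = "\<lambda>r. left_of (fst r) (snd r)"
  have st: "{s, t} \<subseteq> ?D" "s \<noteq> t"
    using s(1) t(1) dist by auto
  \<comment> \<open>At \<open>s\<close> and at \<open>t\<close> both old segments are cut and
    neither new one is.\<close>
  have drop: "cut_number (?L r) M' + (if r \<in> {s, t} then 2 else 0) \<le> cut_number (?L r) M" for r
    using mono[of "fst r" "snd r"] flip[of "?L s"] flip[of "?L t"] s t by auto
  have fin: "finite ?D"
    using pm(2) by simp
  have "potential P M' + 4 = (\<Sum>r\<in>?D. cut_number (?L r) M') + (\<Sum>r\<in>{s, t}. 2)"
    using st by (simp add: potential_def case_prod_unfold)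
  also have "(\<Sum>r\<in>{s, t}. 2) = (\<Sum>r\<in>?D. if r \<in> {s, t} then 2 else (0::nat))"
    using st fin by (intro sum.mono_neutral_cong_left) auto
  also have "(\<Sum>r\<in>?D. cut_number (?L r) M') + \<dots> \<le> (\<Sum>r\<in>?D. cut_number (?L r) M)"
    unfolding sum.distrib[symmetric] by (rule sum_mono) (rule drop)
  finally show "potential P M' + 4 \<le> potential P M"
    by (simp add: potential_def case_prod_unfold)
qed

text \<open>The decreases of 4 add up along the sequence and cannot exceed the initial potential.
  The induction carries the perfect matching along, since \<open>potential_successor\<close>
  requires it.\<close>

lemma valid_sequence_length_le:
  assumes "perfect_matching P M" "finite P" "general_position P" "card P = 2 * n"
    and "valid_sequence M k Ms"
  shows "k \<le> n ^ 3"
proof -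
  have "perfect_matching P (Ms i) \<and> potential P (Ms i) + 4 * i \<le> potential P M" if "i \<le> k" for i
    using that
  proof (induction i)
    case 0
    then show ?case
      using assms by (auto simp: valid_sequence_def)
  next
    case (Suc i)
    then have "successor (Ms i) (Ms (Suc i))"
      using assms by (auto simp: valid_sequence_def)
    from potential_successor[OF _ assms(2,3) this] Suc show ?case
      by fastforce
  qed
  from this[of k] have "4 * k \<le> potential P M"
    by simp
  also have "\<dots> \<le> 4 * n ^ 3"
    by (rule potential_le[OF assms(1,2,4)])
  finally show ?thesis
    by simp
qed

lemma max_flips_of_size_le: "max_flips_of_size n \<le> enat (n ^ 3)"
  unfolding max_flips_of_size_def
proof (rule Sup_least)
  fix x
  assume "x \<in> {max_flips M | P M.
     finite P \<and> card P = 2 * n \<and> general_position P \<and> perfect_matching P M}"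
  then obtain P M where "x = max_flips M" "perfect_matching P M" "finite P"
    "general_position P" "card P = 2 * n"
    by blast
  then show "x \<le> enat (n ^ 3)"
    unfolding max_flips_def by (auto intro!: Sup_least valid_sequence_length_le)
qed

section \<open>Lower bound\<close>

definition parab :: "real \<Rightarrow> point" where
  "parab t = vector [t, t\<^sup>2]"

lemma parab_nth [simp]: "parab t $ 1 = t" "parab t $ 2 = t\<^sup>2"
  by (simp_all add: parab_def)

lemma parab_eq_iff [simp]: "parab s = parab t \<longleftrightarrow> s = t"
  by (metis parab_nth(1))

text \<open>The Vandermonde determinant of \<open>r\<close>, \<open>s\<close>, \<open>t\<close>. It
  gives general position and also the sides of chords.\<close>

lemma orient_parab: "orient (parab r) (parab s) (parab t) = (s - r) * (t - r) * (t - s)"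
  by (simp add: orient_def algebra_simps power2_eq_square)

lemma general_position_parab: "general_position (parab ` T)"
  by (auto simp: general_position_def collinear_iff_orient orient_parab)

lemma chords_cross:
  assumes "u < v" "v < w" "w < z"
  shows "segs_cross (parab u) (parab w) (parab v) (parab z)"
proof -
  define D where "D = v + z - u - w"
  have D: "D > 0"
    using assms by (simp add: D_def)
  \<comment> \<open>The chord with parameters \<open>s\<close>, \<open>t\<close> lies on the line of
    height \<open>(s + t) * x - s * t\<close> at abscissa \<open>x\<close>. Equating this for the
    two chords gives this \<open>x\<close>; \<open>l\<close> and \<open>m\<close> are its relative
    positions on them.\<close>
  define x where "x = (v * z - u * w) / D"
  define l where "l = (x - u) / (w - u)"
  define m where "m = (x - v) / (z - v)"
  \<comment> \<open>These factorisations place \<open>x\<close> strictly between \<open>v\<close>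
    and \<open>w\<close>, hence inside both chords.\<close>
  have "x - u = (v - u) * (z - u) / D" "w - x = (w - v) * (z - w) / D"
    "x - v = (v - u) * (w - v) / D" "z - x = (z - u) * (z - w) / D"
    using D by (simp_all add: x_def field_simps) (simp_all add: D_def algebra_simps)
  then have pos: "x - u > 0" "w - x > 0" "x - v > 0" "z - x > 0"
    using assms D by simp_all
  have l: "0 < l" "l < 1" and m: "0 < m" "m < 1"
    using pos assms by (simp_all add: l_def m_def)
  have on_chord: "(1 - r) * s + r * t = x" "(1 - r) * s\<^sup>2 + r * t\<^sup>2 = (s + t) * x - s * t"
    if "r = (x - s) / (t - s)" "s < t" for r s t
  proof -
    have x: "x = s + r * (t - s)"
      using that by simp
    show "(1 - r) * s + r * t = x" "(1 - r) * s\<^sup>2 + r * t\<^sup>2 = (s + t) * x - s * t"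
      unfolding x by (simp_all add: algebra_simps power2_eq_square)
  qed
  have "u < w" "v < z"
    using assms by simp_all
  note l' = on_chord[OF l_def \<open>u < w\<close>] and m' = on_chord[OF m_def \<open>v < z\<close>]
  have "(u + w) * x - u * w = (v + z) * x - v * z"
  proof -
    have "D * x = v * z - u * w"
      using D by (simp add: x_def)
    then show ?thesis
      by (simp add: D_def algebra_simps)
  qed
  then have "(1 - l) *\<^sub>R parab u + l *\<^sub>R parab w = (1 - m) *\<^sub>R parab v + m *\<^sub>R parab z"
    using l' m' by (simp add: vec_eq_iff forall_2)
  moreover have "(1 - l) *\<^sub>R parab u + l *\<^sub>R parab w \<in> open_segment (parab u) (parab w)"
    "(1 - m) *\<^sub>R parab v + m *\<^sub>R parab z \<in> open_segment (parab v) (parab z)"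
    using l m assms by (auto simp: in_segment)
  ultimately show ?thesis
    using assms unfolding segs_cross_def by (auto simp: doubleton_eq_iff)
qed

text \<open>Both inner endpoints lie strictly on the right of the directed outer chord, so no point
  of the inner chord can have orientation 0 with respect to it.\<close>

lemma nested_chords_not_cross:
  assumes "u < v" "v < w" "w < z"
  shows "\<not> segs_cross (parab u) (parab z) (parab v) (parab w)"
proof
  assume "segs_cross (parab u) (parab z) (parab v) (parab w)"
  then obtain l m where lm: "0 < l" "l < 1" "0 < m" "m < 1"
    "\<And>p q. (1 - l) * orient p q (parab u) + l * orient p q (parab z)
      = (1 - m) * orient p q (parab v) + m * orient p q (parab w)"
    by (rule crossing_orient) blast
  have "(1 - l) * orient (parab u) (parab z) (parab u) + l * orient (parab u) (parab z) (parab z) = 0"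
    by simp
  moreover have "orient (parab u) (parab z) (parab v) < 0" "orient (parab u) (parab z) (parab w) < 0"
    using assms by (auto simp: orient_parab mult_less_0_iff zero_less_mult_iff)
  then have "(1 - m) * orient (parab u) (parab z) (parab v) + m * orient (parab u) (parab z) (parab w) < 0"
    using lm by (intro add_neg_neg mult_pos_neg) auto
  ultimately show False
    using lm(5)[of "parab u" "parab z"] by linarith
qed

section \<open>Matchings encoded by lists\<close>

text \<open>\<open>Suc\<close> keeps both parameters away from 0, where the branches meet and
  \<open>chord 0 0\<close> would collapse to a point.\<close>

definition chord :: "nat \<Rightarrow> nat \<Rightarrow> point set" where
  "chord i j = {parab (- real (Suc i)), parab (real (Suc j))}"

lemma parab_in_chord_iff:
  "parab (- real (Suc i)) \<in> chord k l \<longleftrightarrow> k = i"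
  "parab (real (Suc j)) \<in> chord k l \<longleftrightarrow> l = j"
  by (auto simp: chord_def)

definition list_matching :: "nat list \<Rightarrow> point set set" where
  "list_matching xs = (\<lambda>k. chord k (xs ! k)) ` {..<length xs}"

lemma chord_eq_iff [simp]: "chord i j = chord i' j' \<longleftrightarrow> i = i' \<and> j = j'"
  by (auto simp: chord_def doubleton_eq_iff)

lemma list_matching_decompose:
  assumes "k = length us"
  shows "list_matching (us @ [x, y] @ vs) =
    (\<lambda>i. chord i ((us @ [x, y] @ vs) ! i)) ` ({..<length us + 2 + length vs} - {k, Suc k})
      \<union> {chord k x, chord (Suc k) y}"
proof -
  have eq: "{..<length (us @ [x, y] @ vs)} =
    ({..<length us + 2 + length vs} - {k, Suc k}) \<union> {k, Suc k}"
    using assms by auto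
  show ?thesis
    unfolding list_matching_def eq using assms by (simp add: image_Un nth_append)
qed

text \<open>The four parameters are ordered \<open>-(k+2) < -(k+1) < x+1 < y+1\<close>. Joining
  first with third and second with fourth crosses; joining outer with outer and inner with inner is
  nested.\<close>

lemma successor_swap_adjacent:
  assumes "x < y"
  shows "successor (list_matching (us @ [y, x] @ vs)) (list_matching (us @ [x, y] @ vs))"
proof -
  define k where "k = length us"
  define R where "R = (\<lambda>i. chord i ((us @ [x, y] @ vs) ! i)) `
    ({..<length us + 2 + length vs} - {k, Suc k})"
  have R': "R = (\<lambda>i. chord i ((us @ [y, x] @ vs) ! i)) `
    ({..<length us + 2 + length vs} - {k, Suc k})"
    unfolding R_def
  proof (intro image_cong refl)
    fix i assume "i \<in> {..<length us + 2 + length vs} - {k, Suc k}"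
    then show "chord i ((us @ [x, y] @ vs) ! i) = chord i ((us @ [y, x] @ vs) ! i)"
      by (auto simp: k_def nth_append nth_Cons')
  qed
  have new: "list_matching (us @ [x, y] @ vs) = R \<union> {chord k x, chord (Suc k) y}"
    and old: "list_matching (us @ [y, x] @ vs) = R \<union> {chord k y, chord (Suc k) x}"
    using list_matching_decompose[OF k_def] R_def R' by simp_all
  \<comment> \<open>A chord determines its position, and positions \<open>k\<close> and
    \<open>Suc k\<close> are left out of \<open>R\<close>; so removing the two old chords leaves
    exactly \<open>R\<close>.\<close>
  have R: "chord k y \<notin> R" "chord (Suc k) x \<notin> R"
    by (auto simp: R_def)
  \<comment> \<open>\<open>?c\<close> is on the right branch and \<open>?d\<close> on the left, so
    that the pairing \<open>{a, c}\<close>, \<open>{b, d}\<close> of \<open>successor\<close> yields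
    the swapped chords.\<close>
  let ?a = "parab (- real (Suc k))" and ?b = "parab (real (Suc y))"
  let ?c = "parab (real (Suc x))" and ?d = "parab (- real (Suc (Suc k)))"
  have ch: "chord k y = {?a, ?b}" "chord (Suc k) x = {?c, ?d}"
    "chord k x = {?a, ?c}" "chord (Suc k) y = {?b, ?d}"
    by (auto simp: chord_def)
  have "segs_cross ?d ?c ?a ?b"
    using assms by (intro chords_cross) auto
  then have "segs_cross ?a ?b ?c ?d"
    unfolding segs_cross_def by (auto simp: open_segment_commute insert_commute)
  moreover have "\<not> segs_cross ?d ?b ?a ?c"
    using assms by (intro nested_chords_not_cross) auto
  then have "\<not> segs_cross ?a ?c ?b ?d"
    unfolding segs_cross_def by (auto simp: open_segment_commute insert_commute)
  moreover have "{?a, ?b} \<in> list_matching (us @ [y, x] @ vs)"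
    "{?c, ?d} \<in> list_matching (us @ [y, x] @ vs)"
    unfolding old ch by simp_all
  moreover have "R = list_matching (us @ [y, x] @ vs) - {{?a, ?b}, {?c, ?d}}"
    using R unfolding old ch[symmetric] by auto
  then have "list_matching (us @ [x, y] @ vs) =
      list_matching (us @ [y, x] @ vs) - {{?a, ?b}, {?c, ?d}} \<union> {{?a, ?c}, {?b, ?d}}"
    unfolding new ch by (rule arg_cong)
  ultimately show ?thesis
    unfolding successor_def by (intro exI conjI)
qed

section \<open>Bubble sort as a sequence of flips\<close>

text \<open>One flip per smaller entry passed; the exponent counts flips exactly. The prefix
  \<open>us\<close> is arbitrary in the induction because it absorbs the passed entries.\<close>

lemma successor_move_right:
  assumes "\<forall>x\<in>set xs. x < y"
  shows "((\<lambda>vs ws. successor (list_matching vs) (list_matching ws)) ^^ length xs)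
    (us @ y # xs @ vs) (us @ xs @ y # vs)"
  using assms
proof (induction xs arbitrary: us)
  case (Cons x xs)
  have "successor (list_matching (us @ y # (x # xs) @ vs)) (list_matching ((us @ [x]) @ y # xs @ vs))"
    using successor_swap_adjacent[of x y us "xs @ vs"] Cons.prems by simp
  from relpowp_Suc_I2[of "\<lambda>vs ws. successor (list_matching vs) (list_matching ws)", OF this]
    Cons.IH[of "us @ [x]"] Cons.prems
  show ?case
    by simp
qed simp

text \<open>The largest entry \<open>m\<close> first moves past the \<open>m\<close> others and then
  joins the suffix \<open>vs\<close>; the rest is sorted by induction. Pascal's rule, exposed by
  \<open>numeral_2_eq_2\<close>, adds up the flips.\<close>

lemma successor_bubble_sort:
  "((\<lambda>vs ws. successor (list_matching vs) (list_matching ws)) ^^ (m choose 2))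
    (rev [0..<m] @ vs) ([0..<m] @ vs)"
proof (induction m arbitrary: vs)
  case 0
  show ?case by (simp add: binomial_eq_0)
next
  case (Suc m)
  have "((\<lambda>vs ws. successor (list_matching vs) (list_matching ws)) ^^ m)
    (rev [0..<Suc m] @ vs) (rev [0..<m] @ m # vs)"
    using successor_move_right[of "rev [0..<m]" m "[]" vs] by simp
  from relpowp_trans[OF this Suc.IH] show ?case
    by (simp add: numeral_2_eq_2)
qed

text \<open>\<open>chord k k\<close> joins mirror images and is horizontal at height
  \<open>(k+1)^2\<close>, so different chords share no point.\<close>

lemma non_crossing_sorted: "non_crossing (list_matching [0..<n])"
proof -
  have level: "z $ 2 = (real (Suc k))\<^sup>2"
    if e: "{a, b} = chord k k" and z: "z \<in> open_segment a b" for a b z k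
  proof -
    have "a $ 2 = (real (Suc k))\<^sup>2" "b $ 2 = (real (Suc k))\<^sup>2"
      using e by (auto simp: chord_def doubleton_eq_iff power2_eq_square algebra_simps)
    with z show ?thesis
      by (auto simp: in_segment) (simp add: algebra_simps)
  qed
  have "\<not> segs_cross a b c d"
    if ab: "{a, b} \<in> list_matching [0..<n]" and cd: "{c, d} \<in> list_matching [0..<n]" for a b c d
  proof
    assume cr: "segs_cross a b c d"
    obtain i j where ij: "{a, b} = chord i i" "{c, d} = chord j j"
      using ab cd by (auto simp: list_matching_def)
    obtain z where "z \<in> open_segment a b" "z \<in> open_segment c d"
      using cr by (auto simp: segs_cross_def)
    then have "(real (Suc i))\<^sup>2 = (real (Suc j))\<^sup>2"
      using level ij by metis
    then have "i = j"
      by (simp add: power2_eq_iff)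
    with ij cr show False
      by (simp add: segs_cross_def)
  qed
  then show ?thesis
    unfolding non_crossing_def by blast
qed

text \<open>A left point is covered by the chord at its own position. For a right point,
  surjectivity of the list provides the chord and injectivity its uniqueness.\<close>

lemma perfect_matching_list_matching:
  assumes "bij_betw (\<lambda>k. xs ! k) {..<n} {..<n}" "length xs = n"
  defines "T \<equiv> (\<lambda>i. - real (Suc i)) ` {..<n} \<union> (\<lambda>i. real (Suc i)) ` {..<n}"
  shows "perfect_matching (parab ` T) (list_matching xs)"
proof -
  have inj: "i = j" if "xs ! i = xs ! j" "i < n" "j < n" for i j
    using assms(1) that by (auto simp: bij_betw_def inj_on_def)
  have bound: "xs ! i < n" if "i < n" for i
    using assms(1) that by (auto simp: bij_betw_def)
  have "e \<subseteq> parab ` T \<and> card e = 2" if e: "e \<in> list_matching xs" for e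
  proof -
    obtain k where k: "k < n" "e = chord k (xs ! k)"
      using e assms(2) by (auto simp: list_matching_def)
    have "- real (Suc k) \<in> T" "real (Suc (xs ! k)) \<in> T"
      unfolding T_def using k(1) bound[OF k(1)] by blast+
    then show ?thesis
      unfolding k(2) chord_def by simp
  qed
  moreover have "\<exists>!e. e \<in> list_matching xs \<and> p \<in> e" if p: "p \<in> parab ` T" for p
  proof -
    consider i where "i < n" "p = parab (- real (Suc i))" | j where "j < n" "p = parab (real (Suc j))"
      using p by (auto simp: T_def)
    then show ?thesis
    proof cases
      case 1
      show ?thesis
      proof (rule ex1I[of _ "chord i (xs ! i)"])
        show "chord i (xs ! i) \<in> list_matching xs \<and> p \<in> chord i (xs ! i)"
          unfolding 1(2) parab_in_chord_iff list_matching_def using 1(1) assms(2) by auto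
        show "e = chord i (xs ! i)" if e: "e \<in> list_matching xs \<and> p \<in> e" for e
        proof -
          obtain k where k: "e = chord k (xs ! k)"
            using e by (auto simp: list_matching_def)
          then have "k = i"
            using e 1(2) by (simp only: parab_in_chord_iff)
          then show ?thesis
            using k by simp
        qed
      qed
    next
      case 2
      then have "j \<in> (!) xs ` {..<n}"
        using assms(1) by (simp add: bij_betw_def)
      then obtain i where i: "i < n" "j = xs ! i"
        by auto
      show ?thesis
      proof (rule ex1I[of _ "chord i (xs ! i)"])
        show "chord i (xs ! i) \<in> list_matching xs \<and> p \<in> chord i (xs ! i)"
          unfolding 2(2) parab_in_chord_iff list_matching_def using i assms(2) by auto
        show "e = chord i (xs ! i)" if e: "e \<in> list_matching xs \<and> p \<in> e" for e
        proof -
          obtain k where k: "k < n" "e = chord k (xs ! k)"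
            using e assms(2) by (auto simp: list_matching_def)
          then have "xs ! k = xs ! i"
            using e 2(2) i(2) by (simp only: parab_in_chord_iff)
          then show ?thesis
            using inj k i by blast
        qed
      qed
    qed
  qed
  ultimately show ?thesis
    unfolding perfect_matching_def by (intro conjI[OF ballI ballI])
qed

lemma choose_two_le_max_flips_of_size: "enat (n choose 2) \<le> max_flips_of_size n"
proof -
  define T where "T = (\<lambda>i. - real (Suc i)) ` {..<n} \<union> (\<lambda>i. real (Suc i)) ` {..<n}"
  define M where "M = list_matching (rev [0..<n])"
  have "card T = card ((\<lambda>i. - real (Suc i)) ` {..<n}) + card ((\<lambda>i. real (Suc i)) ` {..<n})"
    unfolding T_def by (intro card_Un_disjoint) auto
  also have "\<dots> = 2 * n"
    by (simp add: card_image inj_on_def)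
  finally have card: "finite (parab ` T)" "card (parab ` T) = 2 * n"
    by (simp_all add: card_image inj_on_def T_def)
  have "bij_betw (\<lambda>k. rev [0..<n] ! k) {..<n} {..<n}"
    by (rule bij_betw_byWitness[where f' = "\<lambda>k. n - Suc k"]) (auto simp: rev_nth)
  then have pm: "perfect_matching (parab ` T) M"
    unfolding T_def M_def by (intro perfect_matching_list_matching) auto
  \<comment> \<open>The relational power is unfolded into an explicit run of lists, whose matchings
    form the valid sequence.\<close>
  obtain f where f: "f 0 = rev [0..<n]" "f (n choose 2) = [0..<n]"
    "\<forall>i<n choose 2. successor (list_matching (f i)) (list_matching (f (Suc i)))"
    using successor_bubble_sort[of n "[]"] unfolding relpowp_fun_conv by auto
  have "valid_sequence M (n choose 2) (list_matching \<circ> f)"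
    using f non_crossing_sorted by (simp add: valid_sequence_def M_def)
  then have "enat (n choose 2) \<le> max_flips M"
    unfolding max_flips_def by (intro Sup_upper) blast
  also have "max_flips M \<le> max_flips_of_size n"
    unfolding max_flips_of_size_def using card pm general_position_parab by (intro Sup_upper) blast
  finally show ?thesis .
qed

lemma real_choose_two: "real (n choose 2) = ((real n)\<^sup>2 - real n) / 2"
proof (induction n)
  case (Suc n)
  have "real (Suc n choose 2) = real n + real (n choose 2)"
    unfolding numeral_2_eq_2 by simp
  also have "\<dots> = real n + ((real n)\<^sup>2 - real n) / 2"
    by (simp only: Suc)
  also have "\<dots> = ((real (Suc n))\<^sup>2 - real (Suc n)) / 2"
    by (simp add: power2_eq_square field_simps)
  finally show ?case .
qed simp

theorem theorem1:
  "\<forall>\<^sub>F n in sequentially.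
     ((real n)\<^sup>2 - real n) / 2 = real (n choose 2) \<and>
     enat (n choose 2) \<le> max_flips_of_size n \<and>
     max_flips_of_size n \<le> enat (n ^ 3)"
  by (intro always_eventually allI conjI real_choose_two[symmetric]
      choose_two_le_max_flips_of_size max_flips_of_size_le)

end
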